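(* Let $\lambda\ge 1$, $n\ge 2$, $k\ge 1$, $1\le s\le k$ be integers such that $P^{(k,s,\lambda)}_{n;I}\neq\emptyset$. Let $$\Omega_1=\left\{d\in E[s+2,k]\ \middle|\ \lambda\binom{d-1}{d-s-1}\equiv 0 \pmod 2\right\},\qquad \Omega_1'=\begin{cases}\{k\}&\text{if $k$ is odd},\\ \emptyset&\text{otherwise},\end{cases}$$ $$\Omega_2=\left\{d\in\{s+1,\ldots,k\}\ \middle|\ \lambda\binom{d-1}{d-1-s}\equiv 0\pmod n\right\}.$$ Then there exist $T_1\subseteq\Omega_1$, $T_1'\subseteq\Omega_1'$ and $T_2\subseteq\Omega_2$ such that $$\dim\left(P^{(k,s,\lambda)}_{n;I}\right)=\begin{cases}2^k-\sum_{j=0}^s\binom{k}{j}-\sum_{d\in T_1}\left(\binom{k}{d-1}+\binom{k}{d}\right)-\delta_{(|T_1'|,1)}&\text{if $n=2$ and $s$ is even},\\[4pt] n^k-\sum_{j=0}^s\binom{k}{j}(n-1)^j-\sum_{d\in T_2}\binom{k}{d}(n-1)^d&\text{otherwise}.\end{cases}$$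
   Context: Fix $n$ symbols $l_1,\ldots,l_n$. An orthogonal array $\mathrm{OA}(\lambda n^s,k,n,s)$ is a $\lambda n^s\times k$ array with entries in $\{l_1,\ldots,l_n\}$ such that in every $\lambda n^s\times s$ subarray (choice of $s$ columns) each of the $n^s$ symbol combinations of $\{l_1,\ldots,l_n\}^s$ appears as a row exactly $\lambda$ times. Its frequency vector is $x\in\mathbb{Z}^{n^k}$, indexed by $\{l_1,\ldots,l_n\}^k$, where $x(i_1,\ldots,i_k)$ is the number of times $(i_1,\ldots,i_k)$ appears as a row of the array. Equivalently, frequency vectors are the non-negative integer vectors $x$ such that for every $\{j_1,\ldots,j_s\}\subseteq\{1,\ldots,k\}$ and every $(i_{j_1},\ldots,i_{j_s})\in\{l_1,\ldots,l_n\}^s$, the sum of $x(i_1,\ldots,i_k)$ over all values of the remaining $k-s$ indices equals $\lambda$. The orthogonal array polytope $P^{(k,s,\lambda)}_{n;I}\subset\mathbb{R}^{n^k}$ is the convex hull of the frequency vectors of all $\mathrm{OA}(\lambda n^s,k,n,s)$. The dimension of a non-empty convex set is the dimension of its affine hull. $\delta_{(x,y)}=1$ if $x=y$ and $0$ otherwise; $E[a,b]$ is the set of even integers in the closed interval $[a,b]$. *)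

theory Defs
  imports "HOL-Analysis.Analysis" "HOL-Number_Theory.Cong"
begin

text \<open>
  The \<open>n\<close> symbols are the elements of a finite type \<open>'l\<close> and the \<open>k\<close> columns are indexed by a
  finite type \<open>'k\<close>, so \<open>n = CARD('l)\<close>, \<open>k = CARD('k)\<close>, and the ambient space is
  \<open>real ^ ('l ^ 'k)\<close>, of dimension \<open>n ^ k\<close>. An array is the list of its rows.
\<close>

definition orthogonal_array :: "nat \<Rightarrow> nat \<Rightarrow> ('l::finite ^ 'k::finite) list \<Rightarrow> bool" where
  "orthogonal_array lam s A \<longleftrightarrow>
     length A = lam * CARD('l) ^ s \<and>
     (\<forall>J :: 'k set. card J = s \<longrightarrow>
        (\<forall>c :: 'k \<Rightarrow> 'l. length (filter (\<lambda>r. \<forall>j\<in>J. r $ j = c j) A) = lam))"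

definition frequency_vector :: "('l::finite ^ 'k::finite) list \<Rightarrow> real ^ ('l ^ 'k)" where
  "frequency_vector A = (\<chi> i. real (count_list A i))"

definition oa_polytope :: "nat \<Rightarrow> nat \<Rightarrow> (real ^ ('l::finite ^ 'k::finite)) set" where
  "oa_polytope s lam = convex hull (frequency_vector ` {A. orthogonal_array lam s A})"

definition Omega1 :: "nat \<Rightarrow> nat \<Rightarrow> nat \<Rightarrow> nat set" where
  "Omega1 k s lam =
     {d. d \<in> {s + 2..k} \<and> even d \<and> [lam * ((d - 1) choose (d - s - 1)) = 0] (mod 2)}"

definition Omega1' :: "nat \<Rightarrow> nat set" where
  "Omega1' k = (if odd k then {k} else {})"

definition Omega2 :: "nat \<Rightarrow> nat \<Rightarrow> nat \<Rightarrow> nat \<Rightarrow> nat set" where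
  "Omega2 n k s lam =
     {d. d \<in> {s + 1..k} \<and> [lam * ((d - 1) choose (d - 1 - s)) = 0] (mod n)}"

end

theory Submission
  imports Defs
begin

text \<open>
  Identify \<open>\<real> ^ (L ^ K)\<close>, with \<open>L\<close> the symbols and \<open>K\<close> the columns, with the tensor product over the
  columns of copies of \<open>\<real> ^ L\<close>. Permuting the symbols within each column and permuting the columns
  carries orthogonal arrays to orthogonal arrays, so the space \<open>D\<close> spanned by the differences of
  frequency vectors, whose dimension is that of the polytope, is invariant under these operations
  (\<open>invariant_difference_space\<close>). In representation-theoretic terms, \<open>\<real> ^ (L ^ K)\<close> splits under the
  wreath product of the two symmetric groups into pairwise non-isomorphic irreducible summands
  \<open>U\<^sub>d\<close>, one for each order \<open>d \<le> k\<close>, with \<open>dim U\<^sub>d = (k choose d) * (n - 1) ^ d\<close>. Hence \<open>D\<close> is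
  the sum of the \<open>U\<^sub>d\<close> over a set of \<^emph>\<open>active\<close> orders, and the theorem is about which orders can
  be inactive.

  This splitting can be made explicit. The summand \<open>U\<^sub>d\<close> is spanned by the interaction
  contrasts \<open>interaction S a b\<close> with \<open>card S = d\<close>, the tensors with factor \<open>e\<^sub>a - e\<^sub>b\<close> in the
  columns of \<open>S\<close> and the constant \<open>1\<close> in the others. For each such tensor \<open>w\<close>, the rank-one map
  \<open>x \<mapsto> (x \<bullet> w) w\<close> is a linear combination of symbol permutations, so an invariant subspace either
  contains \<open>w\<close> or is orthogonal to it (\<open>interaction_mem_or_orthogonal\<close>); and the group is transitive
  on the non-zero interactions of a given order (\<open>interaction_transitive\<close>). Counting a basis of
  interactions then gives the dimension (\<open>dim_invariant_subspace\<close>).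

  Orders up to the strength \<open>s\<close> are inactive, because the counts that the definition of an orthogonal array
  fixes determine the inner products with these interactions. If an order \<open>d > s\<close> is inactive, then
  every frequency vector, not only every difference, is orthogonal to \<open>U\<^sub>d\<close>: exchanging two symbols in a
  column of \<open>S\<close> changes the sign of an interaction. Expanding the vanishing product
  \<open>\<Prod>j\<in>S. (n [r\<^sub>j = a\<^sub>j] - 1)\<close>, summed over the rows \<open>r\<close>, and reducing modulo \<open>n ^ (s + 1)\<close> leaves
  \<open>n dvd \<lambda> (d - 1 choose s)\<close> (\<open>inactive_order_dvd\<close>).

  For two symbols, written as signs, and even \<open>s\<close>, multiplying every other column by a fixed one is a
  further symmetry of the orthogonal arrays. It maps the interaction of an even set \<open>S\<close> that contains the fixed
  column to that of \<open>S\<close> without this column, so an even order \<open>d\<close> is active exactly if \<open>d - 1\<close> is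
  (\<open>binary_active_orders_paired\<close>). Only for odd \<open>k\<close> does the order \<open>k\<close> remain without a partner.
\<close>

section \<open>Tensors and interactions\<close>

definition tensor :: "('k::finite \<Rightarrow> 'l::finite \<Rightarrow> real) \<Rightarrow> real ^ ('l ^ 'k)" where
  "tensor u = (\<chi> i. \<Prod>j\<in>UNIV. u j (i $ j))"

definition contrast :: "'l \<Rightarrow> 'l \<Rightarrow> 'l \<Rightarrow> real" where
  "contrast a b c = of_bool (c = a) - of_bool (c = b)"

definition interaction :: "'k set \<Rightarrow> ('k \<Rightarrow> 'l) \<Rightarrow> ('k \<Rightarrow> 'l) \<Rightarrow> real ^ ('l::finite ^ 'k::finite)" where
  "interaction S a b = tensor (\<lambda>j. if j \<in> S then contrast (a j) (b j) else (\<lambda>_. 1))"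

lemma tensor_nth [simp]: "tensor u $ i = (\<Prod>j\<in>UNIV. u j (i $ j))"
  by (simp add: tensor_def)

lemma interaction_nth:
  "interaction S a b $ i = (\<Prod>j\<in>S. contrast (a j) (b j) (i $ j))"
proof -
  have "interaction S a b $ i = (\<Prod>j\<in>UNIV. if j \<in> S then contrast (a j) (b j) (i $ j) else 1)"
    by (auto simp: interaction_def intro!: prod.cong)
  then show ?thesis
    by (simp add: prod.If_cases)
qed

lemma interaction_eq_0:
  assumes "j \<in> S" "a j = b j"
  shows "interaction S a b = 0"
proof -
  have "interaction S a b $ i = 0" for i
    unfolding interaction_nth by (intro prod_zero bexI [of _ j]) (simp_all add: assms contrast_def)
  then show ?thesis
    by (simp add: vec_eq_iff)
qed

lemma sum_contrast: "(\<Sum>c\<in>UNIV. contrast a b c * f c) = f a - f (b :: 'l::finite)"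
proof -
  have "(\<Sum>c\<in>UNIV. contrast a b c * f c)
      = (\<Sum>c\<in>UNIV. if c = a then f c else 0) - (\<Sum>c\<in>UNIV. if c = b then f c else 0)"
    unfolding sum_subtractf [symmetric] by (rule sum.cong) (auto simp: contrast_def)
  then show ?thesis
    by simp
qed

lemma sum_vec_prod:
  fixes f :: "'k::finite \<Rightarrow> 'l::finite \<Rightarrow> 'a::comm_semiring_1"
  shows "(\<Sum>i\<in>UNIV. \<Prod>j\<in>UNIV. f j (i $ j)) = (\<Prod>j\<in>UNIV. \<Sum>c\<in>UNIV. f j c)"
proof -
  have "(\<Prod>j\<in>UNIV. \<Sum>c\<in>UNIV. f j c) = (\<Sum>g\<in>UNIV. \<Prod>j\<in>UNIV. f j (g j))"
    using prod_sum_PiE [of "UNIV :: 'k set" "\<lambda>_. UNIV" f] by (simp add: PiE_UNIV_domain)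
  also have "\<dots> = (\<Sum>i\<in>UNIV. \<Prod>j\<in>UNIV. f j ((i :: 'l ^ 'k) $ j))"
    by (rule sum.reindex_bij_witness [of _ vec_nth vec_lambda]) auto
  finally show ?thesis ..
qed

lemma inner_tensor: "tensor u \<bullet> tensor v = (\<Prod>j\<in>UNIV. \<Sum>c\<in>UNIV. u j c * v j c)"
  unfolding sum_vec_prod [symmetric] by (simp add: inner_vec_def prod.distrib)

section \<open>Subspaces invariant under the wreath product\<close>

definition pullback :: "('i \<Rightarrow> 'i) \<Rightarrow> real ^ 'i \<Rightarrow> real ^ 'i::finite" where
  "pullback g x = (\<chi> i. x $ g i)"

definition relabel_symbols :: "('k \<Rightarrow> 'l \<Rightarrow> 'l) \<Rightarrow> 'l ^ 'k \<Rightarrow> 'l ^ 'k::finite" where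
  "relabel_symbols \<pi> i = (\<chi> j. \<pi> j (i $ j))"

definition permute_columns :: "('k \<Rightarrow> 'k) \<Rightarrow> 'l ^ 'k \<Rightarrow> 'l ^ 'k::finite" where
  "permute_columns \<sigma> i = (\<chi> j. i $ \<sigma> j)"

definition invariant_subspace :: "(real ^ ('l::finite ^ 'k::finite)) set \<Rightarrow> bool" where
  "invariant_subspace D \<longleftrightarrow> subspace D \<and>
     (\<forall>\<pi>. (\<forall>j. bij (\<pi> j)) \<longrightarrow> pullback (relabel_symbols \<pi>) ` D \<subseteq> D) \<and>
     (\<forall>\<sigma>. bij \<sigma> \<longrightarrow> pullback (permute_columns \<sigma>) ` D \<subseteq> D)"

lemma invariant_subspaceD:
  assumes "invariant_subspace D"
  shows "subspace D"
    and "x \<in> D \<Longrightarrow> \<forall>j. bij (\<pi> j) \<Longrightarrow> pullback (relabel_symbols \<pi>) x \<in> D"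
    and "x \<in> D \<Longrightarrow> bij \<sigma> \<Longrightarrow> pullback (permute_columns \<sigma>) x \<in> D"
  using assms unfolding invariant_subspace_def by (simp_all add: image_subset_iff)

lemma pullback_nth [simp]: "pullback g x $ i = x $ g i"
  by (simp add: pullback_def)

lemma linear_pullback: "linear (pullback g)"
  by (auto intro!: linearI simp: vec_eq_iff)

definition upd :: "'l ^ 'k \<Rightarrow> 'k \<Rightarrow> 'l \<Rightarrow> 'l ^ 'k::finite" where
  "upd i j c = (\<chi> l. if l = j then c else i $ l)"

lemma upd_nth: "upd i j c $ l = (if l = j then c else i $ l)"
  by (simp add: upd_def)

lemma upd_same [simp]: "upd i j (i $ j) = i"
  by (simp add: vec_eq_iff upd_nth)

definition column_op ::
  "'k \<Rightarrow> ('l \<Rightarrow> real) \<Rightarrow> real ^ ('l ^ 'k) \<Rightarrow> real ^ ('l::finite ^ 'k::finite)" where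
  "column_op j u x = (\<chi> i. u (i $ j) * (\<Sum>c\<in>UNIV. u c * x $ upd i j c))"

definition swap_in_column :: "'k \<Rightarrow> 'l \<Rightarrow> 'l \<Rightarrow> 'l ^ 'k \<Rightarrow> 'l ^ 'k::finite" where
  "swap_in_column j a b = relabel_symbols (\<lambda>l. if l = j then Transposition.transpose a b else id)"

lemma swap_in_column_eq:
  "swap_in_column j a b i = upd i j (Transposition.transpose a b (i $ j))"
  by (simp add: vec_eq_iff swap_in_column_def relabel_symbols_def upd_nth)

lemma swap_in_column_mem:
  assumes "invariant_subspace D" "x \<in> D"
  shows "pullback (swap_in_column j a b) x \<in> D"
proof -
  have "\<forall>l. bij (if l = j then Transposition.transpose a b else id)"
    by simp
  from invariant_subspaceD(2) [OF assms this] show ?thesis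
    by (simp add: swap_in_column_def)
qed

text \<open>
  With \<open>u\<close> the factor of a tensor in column \<open>j\<close>, the operator \<open>column_op j u\<close> applies the rank-one
  map \<open>v \<mapsto> (u \<bullet> v) u\<close> to this column. For a contrast it is the identity minus a transposition of
  symbols, so it acts on every invariant subspace.
\<close>

lemma column_op_contrast_mem:
  assumes D: "invariant_subspace D" and x: "x \<in> D"
  shows "column_op j (contrast a b) x \<in> D"
proof (cases "a = b")
  case True
  then have "column_op j (contrast a b) x = 0"
    by (simp add: column_op_def contrast_def vec_eq_iff)
  then show ?thesis
    using D by (simp add: invariant_subspace_def subspace_0)
next
  case False
  have "column_op j (contrast a b) x = x - pullback (swap_in_column j a b) x"
  proof (rule iffD2 [OF vec_eq_iff], rule allI)
    fix i
    have "column_op j (contrast a b) x $ i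
        = contrast a b (i $ j) * (x $ upd i j a - x $ upd i j b)"
      by (simp add: column_op_def sum_contrast)
    also have "\<dots> = x $ upd i j (i $ j) - x $ upd i j (Transposition.transpose a b (i $ j))"
      using False by (simp add: contrast_def Transposition.transpose_def del: upd_same)
    finally show "column_op j (contrast a b) x $ i = (x - pullback (swap_in_column j a b) x) $ i"
      by (simp add: swap_in_column_eq)
  qed
  then show ?thesis
    using subspace_diff [OF invariant_subspaceD(1) [OF D] x swap_in_column_mem [OF D x]] by simp
qed

text \<open>
  The sum over all pairs of symbols of their transposition is a combination of the identity and of
  summation over the symbols. Solved for the latter, this expresses summation over a column by symbol permutations.
\<close>

lemma sum_transpositions:
  fixes f :: "'l::finite \<Rightarrow> real"
  shows "(\<Sum>a\<in>UNIV. \<Sum>b\<in>UNIV. f (Transposition.transpose a b c))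
       = 2 * (\<Sum>a\<in>UNIV. f a) + real CARD('l) * (real CARD('l) - 2) * f c"
proof -
  have card: "real (card (UNIV - {c})) = real CARD('l) - 1"
    by (simp add: card_Diff_subset of_nat_diff Suc_leI)
  have "(\<Sum>b\<in>UNIV. f (Transposition.transpose a b c)) = f a + (real CARD('l) - 1) * f c"
    if "a \<noteq> c" for a
  proof -
    have "(\<Sum>b\<in>UNIV. f (Transposition.transpose a b c)) = f a + (\<Sum>b\<in>UNIV - {c}. f (Transposition.transpose a b c))"
      using that by (subst sum.remove [of _ c]) auto
    also have "(\<Sum>b\<in>UNIV - {c}. f (Transposition.transpose a b c)) = (\<Sum>b\<in>UNIV - {c}. f c)"
      using that by (intro sum.cong) (auto simp: Transposition.transpose_def)
    finally show ?thesis
      by (simp add: card)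
  qed
  moreover have "(\<Sum>b\<in>UNIV. f (Transposition.transpose c b c)) = (\<Sum>a\<in>UNIV. f a)"
    by simp
  ultimately have "(\<Sum>a\<in>UNIV. \<Sum>b\<in>UNIV. f (Transposition.transpose a b c))
     = (\<Sum>a\<in>UNIV. f a) + (\<Sum>a\<in>UNIV - {c}. f a + (real CARD('l) - 1) * f c)"
    by (subst sum.remove [of _ c]) auto
  also have "\<dots> = (\<Sum>a\<in>UNIV. f a) + ((\<Sum>a\<in>UNIV. f a) - f c) + (real CARD('l) - 1) * ((real CARD('l) - 1) * f c)"
    by (simp add: sum.distrib card sum_diff1)
  finally show ?thesis
    by (simp add: algebra_simps)
qed

lemma column_op_one_mem:
  assumes D: "invariant_subspace (D :: (real ^ ('l::finite ^ 'k::finite)) set)" and x: "x \<in> D"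
  shows "column_op j (\<lambda>_. 1) x \<in> D"
proof -
  let ?n = "real CARD('l)"
  have "column_op j (\<lambda>_. 1) x = (1/2) *\<^sub>R
    ((\<Sum>a\<in>UNIV. \<Sum>b\<in>UNIV. pullback (swap_in_column j a b) x) - (?n * (?n - 2)) *\<^sub>R x)"
  proof (rule iffD2 [OF vec_eq_iff], rule allI)
    fix i
    show "column_op j (\<lambda>_. 1) x $ i = ((1/2) *\<^sub>R
      ((\<Sum>a\<in>UNIV. \<Sum>b\<in>UNIV. pullback (swap_in_column j a b) x) - (?n * (?n - 2)) *\<^sub>R x)) $ i"
      using sum_transpositions [of "\<lambda>c. x $ upd i j c" "i $ j"]
      by (simp add: column_op_def swap_in_column_eq)
  qed
  moreover have sub: "subspace D"
    using D by (simp add: invariant_subspace_def)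
  ultimately show ?thesis
    using x swap_in_column_mem [OF D x]
    by (auto intro!: subspace_scale subspace_diff subspace_sum)
qed

text \<open>
  The operator \<open>column_op j (u j)\<close> is self-adjoint and has \<open>tensor u\<close> as an eigenvector, with
  eigenvalue the squared norm of \<open>u j\<close>. So it preserves whether the inner product with \<open>tensor u\<close> vanishes.
\<close>

lemma inner_column_op:
  "column_op j (u j) x \<bullet> tensor u = (\<Sum>c\<in>UNIV. (u j c)\<^sup>2) * (x \<bullet> tensor u)"
proof -
  define F where "F i c = u j (i $ j) * u j c * x $ upd i j c * tensor u $ i" for i c
  have tens: "u j c * tensor u $ i = u j (i $ j) * tensor u $ upd i j c" for i c
  proof -
    have "tensor u $ i = u j (i $ j) * (\<Prod>l\<in>UNIV - {j}. u l (i $ l))" for i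
      by (simp add: prod.remove [of UNIV j])
    moreover have "(\<Prod>l\<in>UNIV - {j}. u l (upd i j c $ l)) = (\<Prod>l\<in>UNIV - {j}. u l (i $ l))"
      by (rule prod.cong) (auto simp: upd_nth)
    ultimately show ?thesis
      by (simp add: upd_nth del: tensor_nth)
  qed
  \<comment> \<open>Exchanging \<open>c\<close> with the entry of \<open>i\<close> in column \<open>j\<close> is an involution of the pairs \<open>(i, c)\<close>.\<close>
  have "F i c = (u j (i $ j))\<^sup>2 * (x $ upd i j c * tensor u $ upd i j c)" for i c
    using tens [of c i] unfolding F_def power2_eq_square
    by (simp del: tensor_nth add: mult.assoc mult.left_commute)
  then have "(\<Sum>i\<in>UNIV. \<Sum>c\<in>UNIV. F i c)
     = (\<Sum>(i, c)\<in>UNIV. (u j (i $ j))\<^sup>2 * (x $ upd i j c * tensor u $ upd i j c))"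
    by (simp add: sum.cartesian_product)
  also have "\<dots> = (\<Sum>(i, c)\<in>UNIV. (u j c)\<^sup>2 * (x $ i * tensor u $ i))"
    by (rule sum.reindex_bij_witness [of _ "\<lambda>(i, c). (upd i j c, i $ j)" "\<lambda>(i, c). (upd i j c, i $ j)"])
       (auto simp: upd_nth vec_eq_iff)
  also have "\<dots> = (\<Sum>i\<in>UNIV. \<Sum>c\<in>UNIV. (u j c)\<^sup>2 * (x $ i * tensor u $ i))"
    by (simp add: sum.cartesian_product)
  also have "\<dots> = (\<Sum>c\<in>UNIV. (u j c)\<^sup>2) * (x \<bullet> tensor u)"
    by (subst sum.swap) (simp only: inner_vec_def inner_real_def sum_product)
  finally show ?thesis
    unfolding F_def inner_vec_def column_op_def inner_real_def vec_lambda_beta sum_distrib_left sum_distrib_right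
    by (simp only: mult.assoc)
qed

text \<open>
  Applying the rank-one operators of all columns to \<open>x\<close> turns it into a multiple of \<open>tensor u\<close>,
  and the inner product with \<open>tensor u\<close> stays non-zero on the way. The induction treats the columns
  one at a time: after the columns in \<open>T\<close>, the vector is a product of the factors of \<open>u\<close> in these columns
  and a function \<open>h\<close> of the remaining ones.
\<close>

lemma tensor_mem_of_column_ops:
  fixes x :: "real ^ ('l::finite ^ 'k::finite)"
  assumes x: "x \<in> D" and "x \<bullet> tensor u \<noteq> 0"
    and D: "subspace D"
    and closed: "\<And>j x. x \<in> D \<Longrightarrow> column_op j (u j) x \<in> D"
  shows "tensor u \<in> D"
proof -
  have "\<exists>y\<in>D. y \<bullet> tensor u \<noteq> 0 \<and>
      (\<exists>h. (\<forall>i. y $ i = (\<Prod>j\<in>T. u j (i $ j)) * h i) \<and>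
           (\<forall>i i'. (\<forall>j. j \<notin> T \<longrightarrow> i $ j = i' $ j) \<longrightarrow> h i = h i'))" (is "?P T")
    if "finite T" for T
    using that
  proof induction
    case empty
    have "x $ i = x $ i'" if "\<forall>j. i $ j = i' $ j" for i i'
      using that by (metis vec_eq_iff)
    then show ?case
      using assms(2) by (intro bexI [OF _ x] conjI exI [of _ "\<lambda>i. x $ i"]) auto
  next
    case (insert j T)
    from insert.IH obtain y h where y: "y \<in> D" "y \<bullet> tensor u \<noteq> 0"
      and yh: "\<forall>i. y $ i = (\<Prod>j\<in>T. u j (i $ j)) * h i"
      and h: "\<forall>i i'. (\<forall>j. j \<notin> T \<longrightarrow> i $ j = i' $ j) \<longrightarrow> h i = h i'"
      by (elim bexE exE conjE) (rule that)
    have "tensor u \<noteq> 0"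
      using y(2) by (metis inner_zero_right)
    then obtain i where "tensor u $ i \<noteq> 0"
      by (metis vec_eq_iff zero_index)
    then have "u j (i $ j) \<noteq> 0"
      by (simp add: prod_zero_iff)
    then have "(\<Sum>c\<in>UNIV. (u j c)\<^sup>2) \<noteq> 0"
      by (subst sum_nonneg_eq_0_iff) auto
    then have 1: "column_op j (u j) y \<bullet> tensor u \<noteq> 0"
      using y(2) by (simp add: inner_column_op)
    have 2: "column_op j (u j) y $ i
        = (\<Prod>j\<in>insert j T. u j (i $ j)) * (\<Sum>c\<in>UNIV. u j c * h (upd i j c))" for i
    proof -
      have "(\<Prod>l\<in>T. u l (upd i j c $ l)) = (\<Prod>l\<in>T. u l (i $ l))" for c
        using insert.hyps by (intro prod.cong) (auto simp: upd_nth)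
      then show ?thesis
        using insert.hyps by (simp add: column_op_def yh sum_distrib_left mult_ac)
    qed
    have 3: "(\<Sum>c\<in>UNIV. u j c * h (upd i j c)) = (\<Sum>c\<in>UNIV. u j c * h (upd i' j c))"
      if "\<And>l. l \<notin> insert j T \<Longrightarrow> i $ l = i' $ l" for i i'
      using that by (intro sum.cong arg_cong2 [of _ _ _ _ "(*)"] h [rule_format]) (auto simp: upd_nth)
    show ?case
    proof (intro bexI [of _ "column_op j (u j) y"] conjI allI impI
        exI [of _ "\<lambda>i. \<Sum>c\<in>UNIV. u j c * h (upd i j c)"])
      fix i i' :: "'l ^ 'k"
      assume "\<forall>l. l \<notin> insert j T \<longrightarrow> i $ l = i' $ l"
      then show "(\<Sum>c\<in>UNIV. u j c * h (upd i j c)) = (\<Sum>c\<in>UNIV. u j c * h (upd i' j c))"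
        by (intro 3) simp
    qed (rule 1 2 closed [OF y(1)])+
  qed
  from this [of UNIV] obtain y h where y: "y \<in> D" "y \<bullet> tensor u \<noteq> 0"
    and yh: "\<And>i. y $ i = tensor u $ i * h i" and h: "\<And>i i'. h i = h i'"
    by auto
  obtain c where c: "\<And>i. h i = c"
    using h by metis
  have "y = c *\<^sub>R tensor u"
    by (simp add: vec_eq_iff yh c mult.commute del: tensor_nth)
  moreover from this y have "c \<noteq> 0"
    by auto
  ultimately have "tensor u = (1 / c) *\<^sub>R y"
    by simp
  with y D show ?thesis
    by (simp add: subspace_scale)
qed

lemma interaction_mem_or_orthogonal:
  assumes D: "invariant_subspace D" and x: "x \<in> D" "x \<bullet> interaction S a b \<noteq> 0"
  shows "interaction S a b \<in> D"
  unfolding interaction_def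
proof (rule tensor_mem_of_column_ops [OF x(1) _ invariant_subspaceD(1) [OF D]])
  show "x \<bullet> tensor (\<lambda>j. if j \<in> S then contrast (a j) (b j) else (\<lambda>_. 1)) \<noteq> 0"
    using x(2) by (simp only: interaction_def not_False_eq_True)
  show "column_op j (if j \<in> S then contrast (a j) (b j) else (\<lambda>_. 1)) y \<in> D" if "y \<in> D" for j y
    using column_op_contrast_mem [OF D that] column_op_one_mem [OF D that] by (cases "j \<in> S") simp_all
qed

lemma ex_bij_two_points:
  fixes a b c d :: 'a
  assumes "a \<noteq> b" "c \<noteq> d"
  shows "\<exists>\<pi>. bij \<pi> \<and> \<pi> a = c \<and> \<pi> b = d"
proof -
  let ?p = "Transposition.transpose a c"
  let ?q = "Transposition.transpose (?p b) d"
  have "bij (?q \<circ> ?p)"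
    by (intro bij_comp) auto
  moreover have "(?q \<circ> ?p) a = c" "(?q \<circ> ?p) b = d"
    using assms by (auto simp: Transposition.transpose_def)
  ultimately show ?thesis
    by blast
qed

lemma ex_bij_image_eq:
  fixes S T :: "'k::finite set"
  assumes "card S = card T"
  shows "\<exists>\<sigma>. bij \<sigma> \<and> \<sigma> ` S = T"
proof -
  obtain f where f: "bij_betw f S T"
    using assms finite_same_card_bij [of S T] by auto
  have "card (- S) = card (- T)"
    using assms by (simp add: Compl_eq_Diff_UNIV card_Diff_subset)
  then obtain g where g: "bij_betw g (- S) (- T)"
    using finite_same_card_bij [of "- S" "- T"] by auto
  have "bij_betw (\<lambda>x. if x \<in> S then f x else g x) (S \<union> - S) (T \<union> - T)"
    by (rule bij_betw_disjoint_Un) (use f g in auto)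
  moreover have "(\<lambda>x. if x \<in> S then f x else g x) ` S = T"
    using f by (auto simp: bij_betw_def)
  ultimately show ?thesis
    by auto
qed

text \<open>
  A permutation of the columns takes \<open>S\<close> to \<open>S'\<close>, and the symmetric group on the symbols is doubly
  transitive, so every column can then be adjusted separately.
\<close>

lemma interaction_transitive:
  assumes D: "invariant_subspace D" and mem: "interaction S a b \<in> D"
    and S: "\<And>j. j \<in> S \<Longrightarrow> a j \<noteq> b j"
    and card: "card S' = card S"
  shows "interaction S' a' b' \<in> D"
proof (cases "\<exists>j\<in>S'. a' j = b' j")
  case True
  then have "interaction S' a' b' = 0"
    using interaction_eq_0 by metis
  then show ?thesis
    using D by (simp add: invariant_subspace_def subspace_0)
next
  case False
  obtain \<sigma> where \<sigma>: "bij \<sigma>" "\<sigma> ` S = S'"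
    using ex_bij_image_eq card by metis
  have "\<exists>\<pi>. bij \<pi> \<and> (j \<in> S' \<longrightarrow> \<pi> (a' j) = a (inv \<sigma> j) \<and> \<pi> (b' j) = b (inv \<sigma> j))" for j
  proof (cases "j \<in> S'")
    case True
    then have "inv \<sigma> j \<in> S"
      using \<sigma> by (metis bij_inv_eq_iff image_iff)
    then show ?thesis
      using True False S ex_bij_two_points by metis
  qed (auto intro: exI [of _ id])
  then obtain \<pi> where \<pi>: "\<And>j. bij (\<pi> j)"
    and \<pi>ab: "\<And>j. j \<in> S' \<Longrightarrow> \<pi> j (a' j) = a (inv \<sigma> j) \<and> \<pi> j (b' j) = b (inv \<sigma> j)"
    by metis
  have "interaction S' a' b' = pullback (relabel_symbols \<pi>) (pullback (permute_columns \<sigma>) (interaction S a b))"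
  proof (rule iffD2 [OF vec_eq_iff], rule allI)
    fix i
    have inj: "inj \<sigma>"
      using \<sigma> by (simp add: bij_is_inj)
    have "contrast (a j) (b j) (\<pi> (\<sigma> j) (i $ \<sigma> j)) = contrast (a' (\<sigma> j)) (b' (\<sigma> j)) (i $ \<sigma> j)"
      if "j \<in> S" for j
    proof -
      have "\<sigma> j \<in> S'"
        using \<sigma> that by auto
      then have "\<pi> (\<sigma> j) (a' (\<sigma> j)) = a j" "\<pi> (\<sigma> j) (b' (\<sigma> j)) = b j"
        using \<pi>ab inj by auto
      then have "\<pi> (\<sigma> j) c = a j \<longleftrightarrow> c = a' (\<sigma> j)" "\<pi> (\<sigma> j) c = b j \<longleftrightarrow> c = b' (\<sigma> j)" for c
        using inj_eq [OF bij_is_inj [OF \<pi>]] by metis+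
      then show ?thesis
        by (simp add: contrast_def)
    qed
    moreover have "inj_on \<sigma> S"
      using inj_on_subset [OF inj subset_UNIV] .
    ultimately show "interaction S' a' b' $ i
        = pullback (relabel_symbols \<pi>) (pullback (permute_columns \<sigma>) (interaction S a b)) $ i"
      unfolding \<sigma>(2) [symmetric]
      by (simp add: interaction_nth prod.reindex relabel_symbols_def permute_columns_def)
  qed
  then show ?thesis
    using D mem \<sigma> \<pi> by (simp add: invariant_subspaceD)
qed

section \<open>The dimension of an invariant subspace\<close>

text \<open>
  The condition \<open>a j \<noteq> b j\<close> excludes the interactions that vanish and so belong to every subspace.
\<close>

definition active_orders :: "(real ^ ('l::finite ^ 'k::finite)) set \<Rightarrow> nat set" where
  "active_orders D = {d. \<exists>S a b. card S = d \<and> (\<forall>j\<in>S. a j \<noteq> b j) \<and> interaction S a b \<in> D}"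

lemma active_ordersI:
  assumes "\<forall>j\<in>S. a j \<noteq> b j" "interaction S a b \<in> D"
  shows "card S \<in> active_orders D"
  unfolding active_orders_def
  using assms by (intro CollectI exI [of _ S] exI [of _ a] exI [of _ b] conjI refl)

lemma interaction_mem:
  assumes "invariant_subspace D" "card S \<in> active_orders D"
  shows "interaction S a b \<in> D"
proof -
  from assms(2) obtain S' a' b' where "card S' = card S" "\<forall>j\<in>S'. a' j \<noteq> b' j" "interaction S' a' b' \<in> D"
    unfolding active_orders_def by (elim CollectE exE conjE) (rule that)
  then show ?thesis
    by (intro interaction_transitive [OF assms(1), of S' a' b' S a b]) simp_all
qed

lemma interaction_orthogonal:
  assumes D: "invariant_subspace D" and "card S \<notin> active_orders D" and x: "x \<in> D"
  shows "x \<bullet> interaction S a b = 0"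
proof (cases "\<exists>j\<in>S. a j = b j")
  case True
  then obtain j where "j \<in> S" "a j = b j"
    by blast
  then show ?thesis
    by (simp add: interaction_eq_0)
next
  case False
  then have "interaction S a b \<notin> D"
    using assms(2) active_ordersI [of S a b D] by blast
  then show ?thesis
    using interaction_mem_or_orthogonal [OF D x] by metis
qed

definition support :: "'l \<Rightarrow> 'l ^ 'k \<Rightarrow> 'k::finite set" where
  "support z i = {j. i $ j \<noteq> z}"

lemma card_support_eq:
  "card {i :: 'l::finite ^ 'k::finite. support z i = S} = (CARD('l) - 1) ^ card S"
proof -
  have "bij_betw (\<lambda>i. restrict (vec_nth i) S) {i :: 'l ^ 'k. support z i = S} (PiE S (\<lambda>_. UNIV - {z}))"
    by (rule bij_betw_byWitness [of _ "\<lambda>g. \<chi> j. if j \<in> S then g j else z"])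
       (auto simp: support_def vec_eq_iff PiE_def extensional_def fun_eq_iff split: if_splits)
  then have "card {i :: 'l ^ 'k. support z i = S} = card (PiE S (\<lambda>_. UNIV - {z}))"
    by (rule bij_betw_same_card)
  also have "\<dots> = (CARD('l) - 1) ^ card S"
    by (simp add: card_PiE card_Diff_subset)
  finally show ?thesis .
qed

lemma card_support_order:
  "card {i :: 'l::finite ^ 'k::finite. card (support z i) = d}
     = (CARD('k) choose d) * (CARD('l) - 1) ^ d"
proof -
  have "{i :: 'l ^ 'k. card (support z i) = d} = (\<Union>S\<in>{S. card S = d}. {i. support z i = S})"
    by auto
  also have "card \<dots> = (\<Sum>S\<in>{S :: 'k set. card S = d}. card {i :: 'l ^ 'k. support z i = S})"
    by (rule card_UN_disjoint) auto
  also have "\<dots> = card {S :: 'k set. card S = d} * (CARD('l) - 1) ^ d"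
    by (simp add: card_support_eq)
  finally show ?thesis
    using n_subsets [of "UNIV :: 'k set" d] by simp
qed

lemma biorthogonal_imp_independent:
  fixes v w :: "'i \<Rightarrow> 'a::euclidean_space"
  assumes "\<And>i j. v i \<bullet> w j = of_bool (i = j)"
  shows "independent (range v)" and "inj v"
proof -
  show inj: "inj v"
    using assms by (intro injI) (metis of_bool_eq_1_iff)
  show "independent (range v)"
    unfolding dependent_def
  proof safe
    fix i
    assume "v i \<in> span (range v - {v i})"
    moreover have "range v - {v i} \<subseteq> {x. x \<bullet> w i = 0}"
      using assms by auto
    moreover have "subspace {x. x \<bullet> w i = 0}"
      by (auto simp: subspace_def inner_simps)
    ultimately have "v i \<bullet> w i = 0"
      using span_minimal by blast
    then show False
      by (simp add: assms)
  qed
qed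

text \<open>
  In each column, the constant \<open>1\<close> and the contrasts \<open>e\<^sub>a - e\<^sub>z\<close> with a fixed symbol \<open>z\<close> form a
  basis of the functions on the symbols, whose dual basis consists of the mean and of the deviations
  from the mean. The tensors of the elements of these two bases are biorthogonal.
\<close>

lemma interaction_basis:
  fixes z :: "'l::finite"
  defines "v \<equiv> \<lambda>i :: 'l ^ 'k::finite. interaction (support z i) (($) i) (\<lambda>_. z)"
  shows "independent (range v)" and "inj v"
proof -
  define w :: "'l ^ 'k \<Rightarrow> real ^ ('l ^ 'k)" where "w i = tensor (\<lambda>j c.
    if i $ j = z then 1 / real CARD('l) else of_bool (c = i $ j) - 1 / real CARD('l))" for i
  have "v i \<bullet> w i' = of_bool (i = i')" for i i'
  proof -
    have column: "(\<Sum>c\<in>UNIV. (if j \<in> support z i then contrast (i $ j) z else (\<lambda>_. 1)) c *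
        (if i' $ j = z then 1 / real CARD('l) else of_bool (c = i' $ j) - 1 / real CARD('l)))
        = of_bool (i $ j = i' $ j)" for j
    proof (cases "i $ j = z")
      case True
      then show ?thesis
        by (auto simp: support_def sum_subtractf)
    next
      case False
      then show ?thesis
        by (simp add: support_def sum_contrast)
    qed
    have "v i \<bullet> w i' = (\<Prod>j\<in>UNIV. of_bool (i $ j = i' $ j))"
      unfolding v_def w_def interaction_def inner_tensor column ..
    also have "\<dots> = of_bool (i = i')"
      by (auto simp: vec_eq_iff prod_zero_iff)
    finally show ?thesis .
  qed
  then show "independent (range v)" "inj v"
    using biorthogonal_imp_independent [of v w] by blast+
qed

text \<open>
  The basis vectors of active order lie in \<open>D\<close> and bound its dimension from below. Those of
  inactive order lie in the orthogonal complement and bound it from above. Both bounds agree, since all basis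
  vectors together number the dimension of the whole space.
\<close>

lemma dim_invariant_subspace:
  fixes D :: "(real ^ ('l::finite ^ 'k::finite)) set"
  assumes D: "invariant_subspace D"
  shows "int (dim D) = int CARD('l) ^ CARD('k)
    - (\<Sum>d\<in>{0..CARD('k)} - active_orders D. int (CARD('k) choose d) * (int CARD('l) - 1) ^ d)"
proof -
  obtain z :: 'l where True
    by blast
  define v where "v i = interaction (support z i) (($) i) (\<lambda>_. z)" for i :: "'l ^ 'k"
  have indep: "independent (v ` I)" and inj: "inj_on v I" for I :: "('l ^ 'k) set"
    using interaction_basis [of z, where 'k = 'k] independent_mono [of "range v" "v ` I"]
    by (auto simp: v_def [abs_def] inj_on_def)
  define I where "I = {i :: 'l ^ 'k. card (support z i) \<in> active_orders D}"
  have "v ` I \<subseteq> D"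
    using interaction_mem [OF D] by (auto simp: v_def I_def)
  then have lower: "card I \<le> dim D"
    using independent_card_le_dim [OF _ indep, of I D] by (simp add: card_image [OF inj])
  have sub: "subspace {x. \<forall>y\<in>D. orthogonal y x}"
    by (auto simp: subspace_def orthogonal_def inner_simps)
  have "v ` (- I) \<subseteq> {x. \<forall>y\<in>D. orthogonal y x}"
    using interaction_orthogonal [OF D] by (auto simp: v_def I_def orthogonal_def)
  from independent_card_le_dim [OF this indep]
  have "card (- I) \<le> dim {x. \<forall>y\<in>D. orthogonal y x}"
    by (simp add: card_image [OF inj])
  moreover have "dim {x. \<forall>y\<in>D. orthogonal y x} + dim D = CARD('l ^ 'k)"
    using dim_subspace_orthogonal_to_vectors [OF invariant_subspaceD(1) [OF D] subspace_UNIV] by simp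
  moreover have "card I + card (- I) = CARD('l ^ 'k)"
    using card_Un_disjoint [of I "- I"] by simp
  ultimately have "dim D + card (- I) = CARD('l) ^ CARD('k)"
    using lower by simp
  moreover have "card (- I) = (\<Sum>d\<in>{0..CARD('k)} - active_orders D. (CARD('k) choose d) * (CARD('l) - 1) ^ d)"
  proof -
    have "card (support z i) \<le> CARD('k)" for i :: "'l ^ 'k"
      by (simp add: card_mono)
    then have "- I = (\<Union>d\<in>{0..CARD('k)} - active_orders D. {i. card (support z i) = d})"
      by (auto simp: I_def)
    also have "card \<dots> = (\<Sum>d\<in>{0..CARD('k)} - active_orders D. card {i :: 'l ^ 'k. card (support z i) = d})"
      by (rule card_UN_disjoint) auto
    finally show ?thesis
      by (simp add: card_support_order)
  qed
  ultimately have "int (CARD('l) ^ CARD('k)) = int (dim D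
      + (\<Sum>d\<in>{0..CARD('k)} - active_orders D. (CARD('k) choose d) * (CARD('l) - 1) ^ d))"
    by simp
  moreover have "int (CARD('l) - 1) = int CARD('l) - 1"
    by (simp add: of_nat_diff Suc_leI)
  ultimately show ?thesis
    by (simp only: of_nat_power of_nat_mult of_nat_add of_nat_sum add_diff_cancel_right')
qed

section \<open>Orthogonal arrays\<close>

definition agree_count :: "('l ^ 'k::finite) list \<Rightarrow> 'k set \<Rightarrow> ('k \<Rightarrow> 'l) \<Rightarrow> nat" where
  "agree_count A J c = length (filter (\<lambda>r. \<forall>j\<in>J. r $ j = c j) A)"

lemma orthogonal_array_iff:
  "orthogonal_array lam s (A :: ('l::finite ^ 'k::finite) list) \<longleftrightarrow>
     length A = lam * CARD('l) ^ s \<and> (\<forall>J c. card J = s \<longrightarrow> agree_count A J c = lam)"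
  unfolding orthogonal_array_def agree_count_def by blast

lemma sum_list_sum_swap:
  "(\<Sum>r\<leftarrow>A. \<Sum>x\<in>X. f r x) = (\<Sum>x\<in>X. \<Sum>r\<leftarrow>A. f r x :: 'a::comm_monoid_add)"
  by (induction A) (simp_all add: sum.distrib)

lemma sum_list_of_bool_agree:
  "(\<Sum>r\<leftarrow>A. of_bool (\<forall>j\<in>J. r $ j = c j)) = (of_nat (agree_count A J c) :: 'a::semiring_1)"
  unfolding agree_count_def by (induction A) auto

lemma agree_count_insert:
  fixes A :: "('l::finite ^ 'k::finite) list"
  assumes "j \<notin> J"
  shows "agree_count A J c = (\<Sum>a\<in>UNIV. agree_count A (insert j J) (c(j := a)))"
proof -
  have "(\<forall>l\<in>insert j J. r $ l = (c(j := a)) l) \<longleftrightarrow> a = r $ j \<and> (\<forall>l\<in>J. r $ l = c l)" for r :: "'l ^ 'k" and a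
    using assms by auto
  then have row: "(\<Sum>a\<in>UNIV. of_bool (\<forall>l\<in>insert j J. r $ l = (c(j := a)) l)) = (of_bool (\<forall>l\<in>J. r $ l = c l) :: nat)"
    for r :: "'l ^ 'k"
    by (simp add: of_bool_conj)
  have "agree_count A J c = (\<Sum>r\<leftarrow>A. of_bool (\<forall>l\<in>J. r $ l = c l))"
    by (simp add: sum_list_of_bool_agree)
  also have "\<dots> = (\<Sum>a\<in>UNIV. \<Sum>r\<leftarrow>A. of_bool (\<forall>l\<in>insert j J. r $ l = (c(j := a)) l))"
    unfolding row [symmetric] by (rule sum_list_sum_swap)
  finally show ?thesis
    by (simp only: sum_list_of_bool_agree of_nat_id)
qed

text \<open>
  An array of strength \<open>s\<close> has every smaller strength as well: summing over the symbols of one more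
  column reduces a set of fewer than \<open>s\<close> columns to a larger one.
\<close>

lemma orthogonal_array_agree_count:
  fixes A :: "('l::finite ^ 'k::finite) list"
  assumes A: "orthogonal_array lam s A" and s: "s \<le> CARD('k)"
  shows "card R \<le> s \<Longrightarrow> agree_count A R c = lam * CARD('l) ^ (s - card R)"
proof (induction "s - card R" arbitrary: R c)
  case 0
  then show ?case
    using A by (simp add: orthogonal_array_iff)
next
  case (Suc m)
  have less: "card R < s"
    using Suc.hyps(2) by linarith
  then have "R \<noteq> UNIV"
    using s by auto
  then obtain j where j: "j \<notin> R"
    by auto
  have "agree_count A (insert j R) c' = lam * CARD('l) ^ (s - Suc (card R))" for c'
  proof -
    have "card (insert j R) = Suc (card R)"
      using j by simp
    with Suc.hyps(1) [of "insert j R" c'] Suc.hyps(2) less show ?thesis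
      by simp
  qed
  then have "agree_count A R c = CARD('l) * (lam * CARD('l) ^ (s - Suc (card R)))"
    by (simp add: agree_count_insert [OF j])
  also have "\<dots> = lam * CARD('l) ^ (s - card R)"
    using less by (simp add: Suc_diff_Suc flip: power_Suc)
  finally show ?case .
qed

lemma frequency_vector_inner:
  "frequency_vector A \<bullet> w = (\<Sum>r\<leftarrow>A. w $ r)"
proof (induction A)
  case Nil
  then show ?case
    by (simp add: frequency_vector_def inner_vec_def)
next
  case (Cons r A)
  have "frequency_vector (r # A) \<bullet> w = (\<Sum>i\<in>UNIV. real (count_list A i) * w $ i + (if i = r then w $ i else 0))"
    unfolding frequency_vector_def inner_vec_def by (intro sum.cong) (auto simp: algebra_simps)
  also have "\<dots> = frequency_vector A \<bullet> w + w $ r"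
    by (simp add: sum.distrib frequency_vector_def inner_vec_def)
  finally show ?case
    using Cons by simp
qed

lemma prod_of_bool: "finite S \<Longrightarrow> (\<Prod>j\<in>S. of_bool (P j)) = (of_bool (\<forall>j\<in>S. P j) :: 'a::comm_semiring_1)"
  by (induction S rule: finite_induct) auto

text \<open>
  Multiplying out the contrasts shows that an inner product with an interaction over \<open>S\<close> depends
  only on how often the combinations of symbols occur in the columns of \<open>S\<close>.
\<close>

lemma frequency_vector_interaction:
  "frequency_vector A \<bullet> interaction S a b
     = (\<Sum>R\<in>Pow S. (-1) ^ card (S - R) * real (agree_count A S (\<lambda>j. if j \<in> R then a j else b j)))"
proof -
  have "interaction S a b $ r
      = (\<Sum>R\<in>Pow S. (-1) ^ card (S - R) * of_bool (\<forall>j\<in>S. r $ j = (if j \<in> R then a j else b j)))" for r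
  proof -
    have "interaction S a b $ r
        = (\<Sum>R\<in>Pow S. (\<Prod>j\<in>R. of_bool (r $ j = a j)) * (\<Prod>j\<in>S - R. - of_bool (r $ j = b j)))"
      using prod_add [of S "\<lambda>j. of_bool (r $ j = a j)" "\<lambda>j. - of_bool (r $ j = b j) :: real"]
      by (simp add: interaction_nth contrast_def)
    also have "\<dots> = (\<Sum>R\<in>Pow S. (-1) ^ card (S - R) * of_bool (\<forall>j\<in>S. r $ j = (if j \<in> R then a j else b j)))"
    proof (rule sum.cong)
      fix R assume "R \<in> Pow S"
      then have "(\<forall>j\<in>S. r $ j = (if j \<in> R then a j else b j))
          \<longleftrightarrow> (\<forall>j\<in>R. r $ j = a j) \<and> (\<forall>j\<in>S - R. r $ j = b j)"
        by auto
      then show "(\<Prod>j\<in>R. of_bool (r $ j = a j)) * (\<Prod>j\<in>S - R. - of_bool (r $ j = b j) :: real)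
          = (-1) ^ card (S - R) * of_bool (\<forall>j\<in>S. r $ j = (if j \<in> R then a j else b j))"
        by (simp only: prod_uminus prod_of_bool finite of_bool_conj mult.left_commute)
    qed simp
    finally show ?thesis .
  qed
  then have "frequency_vector A \<bullet> interaction S a b = (\<Sum>r\<leftarrow>A. \<Sum>R\<in>Pow S. (-1) ^ card (S - R) *
      of_bool (\<forall>j\<in>S. r $ j = (if j \<in> R then a j else b j)))"
    by (simp add: frequency_vector_inner)
  also have "\<dots> = (\<Sum>R\<in>Pow S. \<Sum>r\<leftarrow>A. (-1) ^ card (S - R) *
      of_bool (\<forall>j\<in>S. r $ j = (if j \<in> R then a j else b j)))"
    by (rule sum_list_sum_swap)
  finally show ?thesis
    by (simp only: sum_list_const_mult sum_list_of_bool_agree)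
qed

section \<open>The space of differences of frequency vectors\<close>

definition difference_space :: "nat \<Rightarrow> nat \<Rightarrow> (real ^ ('l::finite ^ 'k::finite)) set" where
  "difference_space lam s = span {frequency_vector A - frequency_vector B | A B.
     orthogonal_array lam s A \<and> orthogonal_array lam s B}"

lemma difference_space_base:
  "orthogonal_array lam s A \<Longrightarrow> orthogonal_array lam s B
    \<Longrightarrow> frequency_vector A - frequency_vector B \<in> difference_space lam s"
  unfolding difference_space_def by (rule span_base) blast

lemma aff_dim_oa_polytope:
  assumes "oa_polytope s lam \<noteq> ({} :: (real ^ ('l::finite ^ 'k::finite)) set)"
  shows "aff_dim (oa_polytope s lam :: (real ^ ('l ^ 'k)) set)
       = int (dim (difference_space lam s :: (real ^ ('l ^ 'k)) set))"
proof -
  define F :: "(real ^ ('l ^ 'k)) set" where "F = frequency_vector ` {A. orthogonal_array lam s A}"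
  obtain B :: "('l ^ 'k) list" where B: "orthogonal_array lam s B"
    using assms by (auto simp: oa_polytope_def)
  then have "frequency_vector B \<in> affine hull F"
    by (auto simp: F_def intro!: hull_inc)
  then have "aff_dim F = int (dim ((\<lambda>x. x - frequency_vector B) ` F))"
    by (rule aff_dim_eq_dim_subtract)
  also have "span ((\<lambda>x. x - frequency_vector B) ` F) = difference_space lam s"
  proof
    have "(\<lambda>x. x - frequency_vector B) ` F \<subseteq> difference_space lam s"
      using B by (auto simp: F_def intro: difference_space_base)
    then show "span ((\<lambda>x. x - frequency_vector B) ` F) \<subseteq> difference_space lam s"
      unfolding difference_space_def by (rule span_minimal) (rule subspace_span)
    have "frequency_vector A - frequency_vector A' \<in> span ((\<lambda>x. x - frequency_vector B) ` F)"
      if "orthogonal_array lam s A" "orthogonal_array lam s A'" for A A' :: "('l ^ 'k) list"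
    proof -
      have "frequency_vector A - frequency_vector A'
          = (frequency_vector A - frequency_vector B) - (frequency_vector A' - frequency_vector B)"
        by simp
      also have "\<dots> \<in> span ((\<lambda>x. x - frequency_vector B) ` F)"
        using that by (intro span_diff span_base) (auto simp: F_def)
      finally show ?thesis .
    qed
    then show "difference_space lam s \<subseteq> span ((\<lambda>x. x - frequency_vector B) ` F)"
      unfolding difference_space_def by (intro span_minimal subspace_span) blast
  qed
  then have "dim ((\<lambda>x. x - frequency_vector B) ` F) = dim (difference_space lam s :: (real ^ ('l ^ 'k)) set)"
    using dim_span [of "(\<lambda>x. x - frequency_vector B) ` F"] by simp
  finally show ?thesis
    by (simp add: oa_polytope_def aff_dim_convex_hull F_def)
qed

lemma pullback_frequency_vector:
  assumes "\<And>i. h (g i) = i" "\<And>i. g (h i) = i"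
  shows "pullback g (frequency_vector A) = frequency_vector (map h A)"
proof -
  have "inj h"
    by (rule inj_on_inverseI [of _ g]) (rule assms(2))
  then have "count_list (map h A) i = count_list A (g i)" for i
    using count_list_map_conv [of h A "g i"] assms(1) by simp
  then show ?thesis
    by (simp add: vec_eq_iff frequency_vector_def)
qed

text \<open>
  Every bijection of the rows that respects orthogonal arrays acts on the space of differences. Besides
  the wreath product this also covers the symmetry that is special to two symbols.
\<close>

lemma pullback_difference_space:
  assumes inverse: "\<And>i. h (g i) = i" "\<And>i. g (h i) = i"
    and preserves: "\<And>A. orthogonal_array lam s A \<Longrightarrow> orthogonal_array lam s (map h A)"
    and x: "x \<in> difference_space lam s"
  shows "pullback g x \<in> difference_space lam s"
proof -
  let ?G = "{frequency_vector A - frequency_vector B | A B.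
     orthogonal_array lam s A \<and> orthogonal_array lam s B}"
  have "pullback g (frequency_vector A - frequency_vector B) \<in> ?G"
    if "orthogonal_array lam s A" "orthogonal_array lam s B" for A B
    unfolding linear_diff [OF linear_pullback] pullback_frequency_vector [OF inverse]
    using preserves [OF that(1)] preserves [OF that(2)] by blast
  then have "pullback g ` ?G \<subseteq> ?G"
    by blast
  then have "span (pullback g ` ?G) \<subseteq> span ?G"
    by (rule span_mono)
  with x show ?thesis
    unfolding difference_space_def linear_span_image [OF linear_pullback] by blast
qed

lemma agree_count_map:
  assumes "\<And>r. (\<forall>j\<in>J. h r $ j = c j) \<longleftrightarrow> (\<forall>j\<in>J'. r $ j = c' j)"
  shows "agree_count (map h A) J c = agree_count A J' c'"
  by (simp add: agree_count_def filter_map o_def assms)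

lemma orthogonal_array_relabel_symbols:
  assumes A: "orthogonal_array lam s A" and \<pi>: "\<forall>j. bij (\<pi> j)"
  shows "orthogonal_array lam s (map (relabel_symbols \<pi>) A)"
proof -
  have "agree_count (map (relabel_symbols \<pi>) A) J c = agree_count A J (\<lambda>j. inv (\<pi> j) (c j))" for J c
    using \<pi> by (intro agree_count_map) (simp add: relabel_symbols_def bij_inv_eq_iff)
  with A show ?thesis
    by (simp add: orthogonal_array_iff)
qed

lemma orthogonal_array_permute_columns:
  assumes A: "orthogonal_array lam s A" and \<sigma>: "bij \<sigma>"
  shows "orthogonal_array lam s (map (permute_columns \<sigma>) A)"
proof -
  have "agree_count (map (permute_columns \<sigma>) A) J c = agree_count A (\<sigma> ` J) (\<lambda>j. c (inv \<sigma> j))" for J c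
    using \<sigma> by (intro agree_count_map) (simp add: permute_columns_def inv_f_f bij_is_inj)
  moreover have "card (\<sigma> ` J) = card J" for J
    by (intro card_image inj_on_subset [OF bij_is_inj [OF \<sigma>]]) simp
  ultimately show ?thesis
    using A by (simp add: orthogonal_array_iff)
qed

lemma invariant_difference_space:
  "invariant_subspace (difference_space lam s :: (real ^ ('l::finite ^ 'k::finite)) set)"
  unfolding invariant_subspace_def
proof (intro conjI allI impI image_subsetI)
  show "subspace (difference_space lam s :: (real ^ ('l ^ 'k)) set)"
    by (simp add: difference_space_def)
next
  fix \<pi> :: "'k \<Rightarrow> 'l \<Rightarrow> 'l" and x :: "real ^ ('l ^ 'k)"
  assume "\<forall>j. bij (\<pi> j)" "x \<in> difference_space lam s"
  then show "pullback (relabel_symbols \<pi>) x \<in> difference_space lam s"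
    by (intro pullback_difference_space [of "relabel_symbols (\<lambda>j. inv (\<pi> j))"] orthogonal_array_relabel_symbols)
       (simp_all add: relabel_symbols_def vec_eq_iff bij_imp_bij_inv bij_is_inj bij_is_surj surj_f_inv_f)
next
  fix \<sigma> :: "'k \<Rightarrow> 'k" and x :: "real ^ ('l ^ 'k)"
  assume "bij \<sigma>" "x \<in> difference_space lam s"
  then show "pullback (permute_columns \<sigma>) x \<in> difference_space lam s"
    by (intro pullback_difference_space [of "permute_columns (inv \<sigma>)"] orthogonal_array_permute_columns)
       (simp_all add: permute_columns_def vec_eq_iff bij_imp_bij_inv bij_is_inj bij_is_surj surj_f_inv_f)
qed

section \<open>Active orders exceed the strength\<close>

lemma orthogonal_array_inner_interaction:
  fixes A B :: "('l::finite ^ 'k::finite) list"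
  assumes "orthogonal_array lam s A" "orthogonal_array lam s B" "s \<le> CARD('k)" "card S \<le> s"
  shows "frequency_vector A \<bullet> interaction S a b = frequency_vector B \<bullet> interaction S a b"
  unfolding frequency_vector_interaction
  using orthogonal_array_agree_count [OF assms(1,3,4)] orthogonal_array_agree_count [OF assms(2,3,4)]
  by simp

text \<open>
  All frequency vectors have the same inner product with an interaction of order at most \<open>s\<close>, so
  \<open>D\<close> is orthogonal to it. A non-zero interaction in \<open>D\<close> would then be orthogonal to itself.
\<close>

lemma low_order_inactive:
  assumes "d \<le> s" "s \<le> CARD('k)"
  shows "d \<notin> active_orders (difference_space lam s :: (real ^ ('l::finite ^ 'k::finite)) set)"
proof
  assume "d \<in> active_orders (difference_space lam s :: (real ^ ('l ^ 'k)) set)"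
  then obtain S :: "'k set" and a b :: "'k \<Rightarrow> 'l" where S: "card S = d" and ab: "\<forall>j\<in>S. a j \<noteq> b j"
    and mem: "interaction S a b \<in> difference_space lam s"
    unfolding active_orders_def by (elim CollectE exE conjE) (rule that)
  have "difference_space lam s \<subseteq> {x. x \<bullet> interaction S a b = 0}"
    unfolding difference_space_def
  proof (rule span_minimal)
    show "subspace {x. x \<bullet> interaction S a b = 0}"
      by (auto simp: subspace_def inner_simps)
    have "(frequency_vector A - frequency_vector B) \<bullet> interaction S a b = 0"
      if "orthogonal_array lam s A" "orthogonal_array lam s B" for A B
      using orthogonal_array_inner_interaction [OF that assms(2), of S a b] assms(1) S
      by (simp add: inner_diff_left)
    then show "{frequency_vector A - frequency_vector B |A B. orthogonal_array lam s A \<and> orthogonal_array lam s B}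
        \<subseteq> {x. x \<bullet> interaction S a b = 0}"
      by blast
  qed
  with mem have "interaction S a b \<bullet> interaction S a b = 0"
    by blast
  then have "interaction S a b = 0"
    by (simp only: inner_eq_zero_iff)
  moreover have "interaction S a b $ (\<chi> j. a j) = 1"
    using ab by (simp add: interaction_nth contrast_def)
  ultimately show False
    by simp
qed

section \<open>Divisibility at an inactive order\<close>

text \<open>
  Inactivity is a statement about differences; it extends to single frequency vectors because exchanging the symbols
  \<open>a j\<close> and \<open>b j\<close> in one column \<open>j\<close> gives another orthogonal array and negates the
  interaction.
\<close>

lemma frequency_vector_orthogonal:
  fixes A :: "('l::finite ^ 'k::finite) list"
  assumes A: "orthogonal_array lam s A"
    and "card S \<notin> active_orders (difference_space lam s :: (real ^ ('l ^ 'k)) set)" and "S \<noteq> {}"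
  shows "frequency_vector A \<bullet> interaction S a b = 0"
proof -
  obtain j where j: "j \<in> S"
    using assms(3) by blast
  define B where "B = map (swap_in_column j (a j) (b j)) A"
  have "orthogonal_array lam s B"
    unfolding B_def swap_in_column_def by (rule orthogonal_array_relabel_symbols [OF A]) simp
  from difference_space_base [OF A this]
  have "(frequency_vector A - frequency_vector B) \<bullet> interaction S a b = 0"
    by (rule interaction_orthogonal [OF invariant_difference_space assms(2)])
  moreover have "interaction S a b $ swap_in_column j (a j) (b j) r = - interaction S a b $ r" for r
  proof -
    let ?q = "swap_in_column j (a j) (b j) r"
    have "interaction S a b $ i = contrast (a j) (b j) (i $ j) * (\<Prod>l\<in>S - {j}. contrast (a l) (b l) (i $ l))" for i
      unfolding interaction_nth by (rule prod.remove [OF finite j])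
    moreover have "(\<Prod>l\<in>S - {j}. contrast (a l) (b l) (?q $ l)) = (\<Prod>l\<in>S - {j}. contrast (a l) (b l) (r $ l))"
      by (rule prod.cong) (auto simp: swap_in_column_eq upd_nth)
    moreover have "contrast (a j) (b j) (?q $ j) = - contrast (a j) (b j) (r $ j)"
      by (auto simp: swap_in_column_eq upd_nth contrast_def Transposition.transpose_def)
    ultimately show ?thesis
      by simp
  qed
  then have "frequency_vector B \<bullet> interaction S a b = - (frequency_vector A \<bullet> interaction S a b)"
    by (simp add: frequency_vector_inner B_def o_def uminus_sum_list_map)
  ultimately show ?thesis
    by (simp add: inner_diff_left)
qed

text \<open>
  As a tensor in \<open>r\<close>, the right-hand side is \<open>n ^ card S\<close> times the orthogonal projection of the
  indicator of agreement with \<open>a\<close> on \<open>S\<close> to the span of the interactions over \<open>S\<close>.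
  Its entries are integers, which makes divisibility arguments possible.
\<close>

lemma sum_interaction:
  fixes r :: "'l::finite ^ 'k::finite"
  shows "(\<Sum>b\<in>PiE S (\<lambda>_. UNIV). interaction S a b $ r)
     = (\<Prod>j\<in>S. real CARD('l) * of_bool (r $ j = a j) + (-1))"
proof -
  have "(\<Sum>b\<in>UNIV. contrast x b y) = real CARD('l) * of_bool (y = x) + (-1)" for x y :: 'l
    by (simp add: contrast_def sum_subtractf)
  then show ?thesis
    unfolding interaction_nth
    using prod_sum_PiE [of S "\<lambda>_. UNIV" "\<lambda>j b. contrast (a j) b (r $ j)"]
    by (simp only: finite simp_thms)
qed

text \<open>
  The inner product of a frequency vector with the tensor above vanishes. Multiplying out its factors
  turns this into a relation between the numbers of rows that agree with \<open>a\<close> on the subsets of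
  \<open>S\<close>.
\<close>

lemma sum_agree_count_eq_0:
  fixes A :: "('l::finite ^ 'k::finite) list"
  assumes "orthogonal_array lam s A"
    and "card S \<notin> active_orders (difference_space lam s :: (real ^ ('l ^ 'k)) set)" and "S \<noteq> {}"
  shows "(\<Sum>R\<in>Pow S. int CARD('l) ^ card R * (-1) ^ card (S - R) * int (agree_count A R a)) = 0"
proof -
  have "0 = (\<Sum>b\<in>PiE S (\<lambda>_. UNIV). \<Sum>r\<leftarrow>A. interaction S a b $ r)"
    using frequency_vector_orthogonal [OF assms, of a] by (simp add: frequency_vector_inner)
  also have "\<dots> = (\<Sum>r\<leftarrow>A. \<Prod>j\<in>S. real CARD('l) * of_bool (r $ j = a j) + (-1))"
    unfolding sum_interaction [symmetric] by (rule sum_list_sum_swap [symmetric])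
  also have "\<dots> = (\<Sum>r\<leftarrow>A. \<Sum>R\<in>Pow S. real CARD('l) ^ card R * (-1) ^ card (S - R) * of_bool (\<forall>j\<in>R. r $ j = a j))"
  proof -
    have "(\<Prod>j\<in>S. real CARD('l) * of_bool (r $ j = a j) + (-1))
        = (\<Sum>R\<in>Pow S. real CARD('l) ^ card R * (-1) ^ card (S - R) * of_bool (\<forall>j\<in>R. r $ j = a j))"
      for r :: "'l ^ 'k"
      unfolding prod_add [OF finite] prod.distrib prod_constant prod_of_bool [OF finite]
      by (simp only: mult.assoc mult.commute [of "of_bool _"])
    then show ?thesis
      by (simp only:)
  qed
  also have "\<dots> = (\<Sum>R\<in>Pow S. real CARD('l) ^ card R * (-1) ^ card (S - R) * real (agree_count A R a))"
    by (simp only: sum_list_sum_swap sum_list_const_mult sum_list_of_bool_agree)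
  also have "\<dots> = real_of_int (\<Sum>R\<in>Pow S. int CARD('l) ^ card R * (-1) ^ card (S - R) * int (agree_count A R a))"
    by simp
  finally show ?thesis
    by linarith
qed

lemma alternating_binomial_partial_sum:
  "(\<Sum>r\<le>m. (-1) ^ r * int (Suc e choose r)) = (-1) ^ m * int (e choose m)"
proof (induction m)
  case (Suc m)
  then show ?case
    by (simp add: distrib_left)
qed simp

lemma sum_subsets_card_le:
  fixes S :: "'k::finite set"
  shows "(\<Sum>R | R \<subseteq> S \<and> card R \<le> s. (-1) ^ card R :: int) = (\<Sum>r\<le>s. (-1) ^ r * int (card S choose r))"
proof -
  have "(\<Sum>R | R \<subseteq> S \<and> card R \<le> s. (-1) ^ card R :: int)
      = (\<Sum>r\<le>s. \<Sum>R | R \<in> {R. R \<subseteq> S \<and> card R \<le> s} \<and> card R = r. (-1) ^ card R)"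
    by (rule sum.group [symmetric, of _ _ card]) (auto intro: finite)
  also have "\<dots> = (\<Sum>r\<le>s. \<Sum>R | R \<subseteq> S \<and> card R = r. (-1) ^ r)"
    by (rule sum.cong [OF refl], rule sum.cong) auto
  finally show ?thesis
    by (simp add: n_subsets mult.commute)
qed

text \<open>
  In the identity of \<open>sum_agree_count_eq_0\<close>, the subsets with at most \<open>s\<close> elements contribute
  \<open>\<plusminus> \<lambda> n ^ s\<close> each, since the array determines their counts, and the larger ones contribute
  multiples of \<open>n ^ (s + 1)\<close>. What remains is an alternating partial sum of binomial coefficients.
\<close>

lemma inactive_order_dvd:
  fixes A :: "('l::finite ^ 'k::finite) list"
  assumes A: "orthogonal_array lam s A"
    and inactive: "d \<notin> active_orders (difference_space lam s :: (real ^ ('l ^ 'k)) set)"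
    and d: "s < d" "d \<le> CARD('k)"
  shows "CARD('l) dvd lam * ((d - 1) choose s)"
proof -
  let ?n = "int CARD('l)"
  obtain S :: "'k set" where S: "card S = d"
    using obtain_subset_with_card_n [OF d(2)] by blast
  then have "S \<noteq> {}"
    using d by auto
  obtain a :: "'k \<Rightarrow> 'l" where True
    by blast
  define f where "f R = ?n ^ card R * (-1) ^ card (S - R) * int (agree_count A R a)" for R
  have low: "f R = ?n ^ s * (int lam * (-1) ^ d * (-1) ^ card R)" if "R \<subseteq> S" "card R \<le> s" for R
  proof -
    have "int (agree_count A R a) = int lam * ?n ^ (s - card R)"
      using orthogonal_array_agree_count [OF A _ that(2)] d by simp
    moreover have "?n ^ card R * ?n ^ (s - card R) = ?n ^ s"
      using that by (simp flip: power_add)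
    moreover have "(-1 :: int) ^ card (S - R) = (-1) ^ d * (-1) ^ card R"
      using that(1) S card_mono [of S R] by (simp add: card_Diff_subset minus_one_power_iff)
    ultimately show ?thesis
      by (simp add: f_def mult_ac)
  qed
  have high: "?n ^ Suc s dvd f R" if "\<not> card R \<le> s" for R
  proof -
    have "?n ^ Suc s dvd ?n ^ card R"
      using that by (intro le_imp_power_dvd) simp
    then show ?thesis
      by (simp add: f_def mult.assoc)
  qed
  have "Pow S = {R. R \<subseteq> S \<and> card R \<le> s} \<union> {R. R \<subseteq> S \<and> \<not> card R \<le> s}"
    by auto
  then have "(\<Sum>R\<in>Pow S. f R) = (\<Sum>R | R \<subseteq> S \<and> card R \<le> s. f R) + (\<Sum>R | R \<subseteq> S \<and> \<not> card R \<le> s. f R)"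
    by (simp only:) (rule sum.union_disjoint, auto)
  also have "(\<Sum>R\<in>Pow S. f R) = 0"
    unfolding f_def using A inactive S \<open>S \<noteq> {}\<close> by (intro sum_agree_count_eq_0) simp_all
  finally have "(\<Sum>R | R \<subseteq> S \<and> card R \<le> s. f R) = - (\<Sum>R | R \<subseteq> S \<and> \<not> card R \<le> s. f R)"
    by linarith
  moreover have "?n ^ Suc s dvd (\<Sum>R | R \<subseteq> S \<and> \<not> card R \<le> s. f R)"
    by (rule dvd_sum) (simp add: high del: power_Suc)
  ultimately have "?n ^ Suc s dvd (\<Sum>R | R \<subseteq> S \<and> card R \<le> s. f R)"
    by (simp del: power_Suc)
  also have "(\<Sum>R | R \<subseteq> S \<and> card R \<le> s. f R)
      = ?n ^ s * (int lam * (-1) ^ d * (\<Sum>R | R \<subseteq> S \<and> card R \<le> s. (-1) ^ card R))"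
    unfolding sum_distrib_left by (rule sum.cong) (simp_all add: low)
  also have "(\<Sum>R | R \<subseteq> S \<and> card R \<le> s. (-1) ^ card R) = (-1) ^ s * int ((d - 1) choose s)"
    using alternating_binomial_partial_sum [of "d - 1" s] d S by (simp add: sum_subsets_card_le)
  finally have "?n ^ s * ?n dvd ?n ^ s * (int lam * (-1) ^ d * ((-1) ^ s * int ((d - 1) choose s)))"
    by (simp add: mult.commute)
  then have "?n dvd int lam * (-1) ^ d * ((-1) ^ s * int ((d - 1) choose s))"
    by simp
  then have "?n dvd int (lam * ((d - 1) choose s))"
    by (simp add: minus_one_power_iff split: if_splits)
  then show ?thesis
    by (simp only: of_nat_dvd_iff)
qed

section \<open>An additional symmetry for two symbols and even strength\<close>

text \<open>
  With \<open>p\<close> and \<open>q\<close> written as \<open>1\<close> and \<open>-1\<close>, this multiplies every column other than \<open>j0\<close> by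
  column \<open>j0\<close>.
\<close>

definition twist :: "'k \<Rightarrow> 'l \<Rightarrow> 'l \<Rightarrow> 'l ^ 'k \<Rightarrow> 'l ^ 'k::finite" where
  "twist j0 p q i = (\<chi> j. if j = j0 \<or> i $ j0 = p then i $ j else Transposition.transpose p q (i $ j))"

lemma twist_involution [simp]: "twist j0 p q (twist j0 p q i) = i"
  by (simp add: twist_def vec_eq_iff)

lemma agree_count_flip_column:
  fixes A :: "('l::finite ^ 'k::finite) list"
  assumes A: "orthogonal_array lam s A" and UNIV: "UNIV = {p, q :: 'l}" and "p \<noteq> q"
    and K: "card K = Suc s" "j \<in> K"
  shows "agree_count A K c + agree_count A K (c(j := Transposition.transpose p q (c j))) = lam"
proof -
  let ?c' = "Transposition.transpose p q (c j)"
  have "c j = p \<or> c j = q"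
    using UNIV by auto
  then have both: "{c j, ?c'} = UNIV" and "c j \<noteq> ?c'"
    using UNIV \<open>p \<noteq> q\<close> by auto
  then have "(\<Sum>a\<in>{c j, ?c'}. f a) = f (c j) + f ?c'" for f :: "'l \<Rightarrow> nat"
    by (subst sum.insert) simp_all
  then have sum: "(\<Sum>a\<in>UNIV. f a) = f (c j) + f ?c'" for f :: "'l \<Rightarrow> nat"
    unfolding both .
  have "insert j (K - {j}) = K"
    using K by auto
  then have "agree_count A (K - {j}) c = (\<Sum>a\<in>UNIV. agree_count A K (c(j := a)))"
    using agree_count_insert [of j "K - {j}" A c] by simp
  also have "\<dots> = agree_count A K c + agree_count A K (c(j := ?c'))"
    unfolding sum by simp
  finally have "agree_count A K c + agree_count A K (c(j := ?c')) = agree_count A (K - {j}) c" ..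
  also have "\<dots> = lam"
    using A K by (simp add: orthogonal_array_iff card_Diff_singleton)
  finally show ?thesis .
qed

text \<open>
  Two rows over \<open>s + 1\<close> columns that differ in exactly one of these columns agree in \<open>s\<close> columns, so their
  frequencies add up to \<open>\<lambda>\<close>. Each single flip therefore replaces a frequency \<open>x\<close> by
  \<open>\<lambda> - x\<close>.
\<close>

lemma agree_count_flip_columns:
  fixes A :: "('l::finite ^ 'k::finite) list"
  assumes A: "orthogonal_array lam s A" and UNIV: "UNIV = {p, q :: 'l}" and "p \<noteq> q"
    and K: "card K = Suc s" "F \<subseteq> K"
  shows "int (agree_count A K (\<lambda>j. if j \<in> F then Transposition.transpose p q (c j) else c j))
       = (if even (card F) then int (agree_count A K c) else int lam - int (agree_count A K c))"
proof -
  have "finite F"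
    by simp
  then show ?thesis
    using K(2)
  proof (induction F rule: finite_induct)
    case (insert j F)
    let ?flip = "\<lambda>F j. if j \<in> F then Transposition.transpose p q (c j) else c j"
    have "?flip (insert j F) = (?flip F)(j := Transposition.transpose p q (?flip F j))"
      using insert.hyps by auto
    moreover have "agree_count A K (?flip F)
        + agree_count A K ((?flip F)(j := Transposition.transpose p q (?flip F j))) = lam"
      using insert.prems by (intro agree_count_flip_column [OF assms(1-4)]) simp
    ultimately have "int (agree_count A K (?flip (insert j F))) = int lam - int (agree_count A K (?flip F))"
      by simp
    also have "int (agree_count A K (?flip F))
        = (if even (card F) then int (agree_count A K c) else int lam - int (agree_count A K c))"
      using insert.IH insert.prems by simp
    finally show ?case
      using insert.hyps by simp
  qed simp
qed

text \<open>
  On sets of columns that contain \<open>j0\<close>, the twist only renames the prescribed symbols. For other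
  sets \<open>J\<close>, the rows with symbol \<open>p\<close> in column \<open>j0\<close> and those with symbol \<open>q\<close> contribute the
  frequencies of two complementary rows over \<open>s + 1\<close> columns. As \<open>s + 1\<close> is odd, these add up
  to \<open>\<lambda>\<close>.
\<close>

lemma orthogonal_array_twist:
  fixes A :: "('l::finite ^ 'k::finite) list"
  assumes A: "orthogonal_array lam s A" and UNIV: "UNIV = {p, q :: 'l}" and "p \<noteq> q" and "even s"
  shows "orthogonal_array lam s (map (twist j0 p q) A)"
proof -
  have twisted: "agree_count (map (twist j0 p q) A) J c
      = agree_count A J (\<lambda>j. if j = j0 \<or> c j0 = p then c j else Transposition.transpose p q (c j))"
    if "j0 \<in> J" for J c
  proof (rule agree_count_map)
    fix r :: "'l ^ 'k"
    have "twist j0 p q r $ j0 = r $ j0"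
      by (simp add: twist_def)
    moreover have "twist j0 p q r $ j = c j
        \<longleftrightarrow> r $ j = (if j = j0 \<or> c j0 = p then c j else Transposition.transpose p q (c j))"
      if "r $ j0 = c j0" for j
    proof -
      have "Transposition.transpose p q (r $ j) = c j \<longleftrightarrow> r $ j = Transposition.transpose p q (c j)"
        by (metis transpose_involutory)
      with that show ?thesis
        by (simp add: twist_def)
    qed
    ultimately show "(\<forall>j\<in>J. twist j0 p q r $ j = c j)
        \<longleftrightarrow> (\<forall>j\<in>J. r $ j = (if j = j0 \<or> c j0 = p then c j else Transposition.transpose p q (c j)))"
      using \<open>j0 \<in> J\<close> by (metis (full_types))
  qed
  have "agree_count (map (twist j0 p q) A) J c = lam" if J: "card J = s" for J c
  proof (cases "j0 \<in> J")
    case True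
    then show ?thesis
      using A J by (simp add: twisted orthogonal_array_iff)
  next
    case False
    define K where "K = insert j0 J"
    have K: "card K = Suc s" "j0 \<in> K"
      using False J by (simp_all add: K_def)
    let ?c = "c(j0 := p)"
    have "agree_count (map (twist j0 p q) A) J c
        = (\<Sum>a\<in>{p, q}. agree_count (map (twist j0 p q) A) K (c(j0 := a)))"
      unfolding K_def UNIV [symmetric] by (rule agree_count_insert [OF False])
    also have "\<dots> = agree_count A K ?c + agree_count A K (\<lambda>j. Transposition.transpose p q (?c j))"
    proof -
      have "(\<lambda>j. if j = j0 \<or> (c(j0 := p)) j0 = p then (c(j0 := p)) j
          else Transposition.transpose p q ((c(j0 := p)) j)) = ?c"
        by auto
      moreover have "(\<lambda>j. if j = j0 \<or> (c(j0 := q)) j0 = p then (c(j0 := q)) j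
          else Transposition.transpose p q ((c(j0 := q)) j)) = (\<lambda>j. Transposition.transpose p q (?c j))"
        using \<open>p \<noteq> q\<close> by auto
      ultimately show ?thesis
        using \<open>p \<noteq> q\<close> by (simp only: twisted [OF K(2)] sum.insert finite.intros empty_iff insert_iff
            sum.empty simp_thms add_0_right)
    qed
    also have "agree_count A K (\<lambda>j. Transposition.transpose p q (?c j))
        = agree_count A K (\<lambda>j. if j \<in> K then Transposition.transpose p q (?c j) else ?c j)"
      by (simp add: agree_count_def)
    also have "int (agree_count A K ?c + \<dots>) = int lam"
      using agree_count_flip_columns [OF A UNIV \<open>p \<noteq> q\<close> K(1) subset_refl, of ?c] \<open>even s\<close> K(1)
      by simp
    finally show ?thesis
      by simp
  qed
  then show ?thesis
    using A by (simp add: orthogonal_array_iff)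
qed

text \<open>
  In the notation with signs, the interaction over \<open>S\<close> is the product of the columns in \<open>S\<close>. The twist
  introduces the sign of column \<open>j0\<close> once for each other element of \<open>S\<close>; together with column \<open>j0\<close>
  itself this is an even power.
\<close>

lemma pullback_twist_interaction:
  fixes p q :: "'l::finite" and S :: "'k::finite set"
  assumes UNIV: "UNIV = {p, q}" and "p \<noteq> q" and S: "even (card S)" "j0 \<in> S"
  shows "pullback (twist j0 p q) (interaction S (\<lambda>_. p) (\<lambda>_. q)) = interaction (S - {j0}) (\<lambda>_. p) (\<lambda>_. q)"
proof (rule iffD2 [OF vec_eq_iff], rule allI)
  fix i :: "'l ^ 'k"
  have symbols: "c = p \<or> c = q" for c
    using UNIV by auto
  let ?\<chi> = "\<lambda>j. contrast p q (i $ j)"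
  have "contrast p q (twist j0 p q i $ j) = ?\<chi> j0 * ?\<chi> j" if "j \<noteq> j0" for j
    using that symbols [of "i $ j"] symbols [of "i $ j0"] \<open>p \<noteq> q\<close>
    by (auto simp: twist_def contrast_def)
  then have "(\<Prod>j\<in>S - {j0}. contrast p q (twist j0 p q i $ j)) = (\<Prod>j\<in>S - {j0}. ?\<chi> j0 * ?\<chi> j)"
    by (intro prod.cong) auto
  moreover have "twist j0 p q i $ j0 = i $ j0"
    by (simp add: twist_def)
  ultimately have "interaction S (\<lambda>_. p) (\<lambda>_. q) $ twist j0 p q i
      = ?\<chi> j0 * (\<Prod>j\<in>S - {j0}. ?\<chi> j0 * ?\<chi> j)"
    unfolding interaction_nth by (simp add: prod.remove [OF finite S(2)])
  also have "\<dots> = ?\<chi> j0 ^ Suc (card (S - {j0})) * (\<Prod>j\<in>S - {j0}. ?\<chi> j)"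
    by (simp add: prod.distrib)
  also have "Suc (card (S - {j0})) = card S"
    using S(2) by (intro card_Suc_Diff1) simp_all
  also have "?\<chi> j0 ^ card S = 1"
    using symbols [of "i $ j0"] \<open>p \<noteq> q\<close> S(1) by (auto simp: contrast_def)
  finally show "pullback (twist j0 p q) (interaction S (\<lambda>_. p) (\<lambda>_. q)) $ i
      = interaction (S - {j0}) (\<lambda>_. p) (\<lambda>_. q) $ i"
    by (simp add: interaction_nth)
qed

lemma binary_active_orders_paired:
  fixes d s lam :: nat
  defines "Act \<equiv> active_orders (difference_space lam s :: (real ^ ('l::finite ^ 'k::finite)) set)"
  assumes n: "CARD('l) = 2" and "even s" and d: "even d" "0 < d" "d \<le> CARD('k)"
  shows "d \<in> Act \<longleftrightarrow> d - 1 \<in> Act"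
proof -
  let ?D = "difference_space lam s :: (real ^ ('l ^ 'k)) set"
  obtain p q :: 'l where pq: "UNIV = {p, q}" "p \<noteq> q"
    using n by (meson card_2_iff)
  obtain S :: "'k set" where S: "card S = d"
    using obtain_subset_with_card_n [OF d(3)] by blast
  then have "S \<noteq> {}"
    using d(2) by auto
  then obtain j0 where j0: "j0 \<in> S"
    by blast
  let ?w = "\<lambda>S :: 'k set. interaction S (\<lambda>_. p) (\<lambda>_. q)"
  have closed: "pullback (twist j0 p q) x \<in> ?D" if "x \<in> ?D" for x
    by (rule pullback_difference_space [where h = "twist j0 p q", OF _ _ _ that])
       (simp_all add: orthogonal_array_twist [OF _ pq \<open>even s\<close>])
  have twist: "pullback (twist j0 p q) (?w S) = ?w (S - {j0})"
    using S d j0 pq by (intro pullback_twist_interaction) auto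
  then have "pullback (twist j0 p q) (?w (S - {j0})) = ?w S"
    by (simp add: vec_eq_iff flip: twist)
  with closed [of "?w S"] closed [of "?w (S - {j0})"] twist
  have "?w S \<in> ?D \<longleftrightarrow> ?w (S - {j0}) \<in> ?D"
    by auto
  moreover have "?w S' \<in> ?D \<longleftrightarrow> card S' \<in> Act" for S'
  proof
    show "card S' \<in> Act" if "?w S' \<in> ?D"
      unfolding Act_def by (rule active_ordersI [OF _ that]) (simp add: pq(2))
    show "?w S' \<in> ?D" if "card S' \<in> Act"
      using that unfolding Act_def by (rule interaction_mem [OF invariant_difference_space])
  qed
  ultimately show ?thesis
    using S j0 by (simp add: card_Diff_singleton)
qed

text \<open>
  As \<open>s\<close> is even, the orders above \<open>s\<close> split into the pairs \<open>{d - 1, d}\<close> with \<open>d\<close> even, except for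
  the single order \<open>k\<close> if \<open>k\<close> is odd.
\<close>

lemma sum_paired_orders:
  fixes f :: "nat \<Rightarrow> int"
  assumes T: "T \<subseteq> {s + 1..k}" and "even s"
    and paired: "\<And>d. even d \<Longrightarrow> s + 2 \<le> d \<Longrightarrow> d \<le> k \<Longrightarrow> d \<in> T \<longleftrightarrow> d - 1 \<in> T"
  shows "(\<Sum>d\<in>T. f d) = (\<Sum>d | d \<in> T \<and> even d. f (d - 1) + f d) + (if odd k \<and> k \<in> T then f k else 0)"
proof -
  let ?E = "{d \<in> T. even d}"
  let ?R = "{d \<in> T. d = k \<and> odd k}"
  have fin: "finite T"
    using T finite_subset by blast
  have E: "s + 2 \<le> d" "d \<le> k" if "d \<in> ?E" for d
  proof -
    have "d \<noteq> s + 1"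
      using that \<open>even s\<close> by auto
    then show "s + 2 \<le> d" "d \<le> k"
      using that T by (fastforce, auto)
  qed
  have "T = (?E \<union> (\<lambda>d. d - 1) ` ?E) \<union> ?R"
  proof (intro equalityI subsetI)
    fix d assume d: "d \<in> T"
    then have range: "s + 1 \<le> d" "d \<le> k"
      using T by auto
    show "d \<in> (?E \<union> (\<lambda>d. d - 1) ` ?E) \<union> ?R"
    proof (cases "even d \<or> d = k")
      case True
      with d show ?thesis
        by auto
    next
      case False
      then have "Suc d \<in> ?E"
        using paired [of "Suc d"] d range by simp
      then have "d \<in> (\<lambda>d. d - 1) ` ?E"
        by (intro image_eqI [of _ _ "Suc d"]) simp_all
      then show ?thesis
        by blast
    qed
  next
    fix d assume "d \<in> (?E \<union> (\<lambda>d. d - 1) ` ?E) \<union> ?R"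
    then show "d \<in> T"
      using paired E by blast
  qed
  then have "(\<Sum>d\<in>T. f d) = sum f ((?E \<union> (\<lambda>d. d - 1) ` ?E) \<union> ?R)"
    by (rule arg_cong)
  also have "\<dots> = sum f (?E \<union> (\<lambda>d. d - 1) ` ?E) + sum f ?R"
    using fin E by (intro sum.union_disjoint) fastforce+
  also have "sum f (?E \<union> (\<lambda>d. d - 1) ` ?E) = sum f ?E + sum f ((\<lambda>d. d - 1) ` ?E)"
    using fin E by (intro sum.union_disjoint) fastforce+
  also have "sum f ((\<lambda>d. d - 1) ` ?E) = (\<Sum>d\<in>?E. f (d - 1))"
  proof (subst sum.reindex)
    show "inj_on (\<lambda>d. d - 1) ?E"
      using E by (intro inj_onI) fastforce
  qed simp
  also have "sum f ?R = (if odd k \<and> k \<in> T then f k else 0)"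
  proof -
    have "?R = (if odd k \<and> k \<in> T then {k} else {})"
      by auto
    then show ?thesis
      by simp
  qed
  finally show ?thesis
    by (simp add: sum.distrib)
qed

section \<open>The dimension formula\<close>

lemma inactive_orders_subset_Omega2:
  fixes A :: "('l::finite ^ 'k::finite) list"
  assumes A: "orthogonal_array lam s A"
  shows "{s + 1..CARD('k)} - active_orders (difference_space lam s :: (real ^ ('l ^ 'k)) set)
    \<subseteq> Omega2 CARD('l) CARD('k) s lam"
proof
  fix d
  assume d: "d \<in> {s + 1..CARD('k)} - active_orders (difference_space lam s :: (real ^ ('l ^ 'k)) set)"
  then have "CARD('l) dvd lam * ((d - 1) choose s)"
    using inactive_order_dvd [OF A] by simp
  moreover have "(d - 1) choose s = (d - 1) choose (d - 1 - s)"
    using d by (intro binomial_symmetric) auto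
  ultimately show "d \<in> Omega2 CARD('l) CARD('k) s lam"
    using d by (simp add: Omega2_def cong_0_iff)
qed

theorem theorem1:
  fixes lam n k s :: nat
    and P :: "(real ^ ('l::finite ^ 'k::finite)) set"
  assumes "n = CARD('l)" and "k = CARD('k)"
    and "lam \<ge> 1" and "n \<ge> 2" and "k \<ge> 1" and "1 \<le> s" and "s \<le> k"
    and "P = oa_polytope s lam"
    and "P \<noteq> {}"
  shows "\<exists>T1 T1' T2. T1 \<subseteq> Omega1 k s lam \<and> T1' \<subseteq> Omega1' k \<and> T2 \<subseteq> Omega2 n k s lam \<and>
    aff_dim P =
      (if n = 2 \<and> even s then
         2 ^ k - (\<Sum>j=0..s. int (k choose j))
           - (\<Sum>d\<in>T1. int (k choose (d - 1)) + int (k choose d))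
           - (if card T1' = 1 then 1 else 0)
       else
         int n ^ k - (\<Sum>j=0..s. int (k choose j) * (int n - 1) ^ j)
           - (\<Sum>d\<in>T2. int (k choose d) * (int n - 1) ^ d))"
proof -
  define D :: "(real ^ ('l ^ 'k)) set" where "D = difference_space lam s"
  define T where "T = {s + 1..k} - active_orders D"
  obtain A :: "('l ^ 'k) list" where A: "orthogonal_array lam s A"
    using assms by (auto simp: oa_polytope_def)
  have T: "T \<subseteq> Omega2 n k s lam"
    unfolding T_def D_def assms(1,2) by (rule inactive_orders_subset_Omega2 [OF A])
  have "{0..k} - active_orders D = {0..s} \<union> T"
    using low_order_inactive [where 'l = 'l and 'k = 'k, of _ s lam] assms by (auto simp: T_def D_def)
  moreover have "{0..s} \<inter> T = {}"
    by (auto simp: T_def)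
  ultimately have dim: "aff_dim P = int n ^ k - (\<Sum>j=0..s. int (k choose j) * (int n - 1) ^ j)
      - (\<Sum>d\<in>T. int (k choose d) * (int n - 1) ^ d)"
    using dim_invariant_subspace [OF invariant_difference_space [where 'l = 'l and 'k = 'k, of lam s]]
      aff_dim_oa_polytope [where 'l = 'l and 'k = 'k, of s lam] assms
    by (simp add: D_def T_def sum.union_disjoint)
  show ?thesis
  proof (cases "n = 2 \<and> even s")
    case False
    with T dim show ?thesis
      by (intro exI [of _ "{}"] exI [of _ T]) (simp only: empty_subsetI if_False simp_thms)
  next
    case True
    define T1 where "T1 = {d \<in> T. even d}"
    define T1' where "T1' = {d \<in> T. d = k \<and> odd k}"
    \<comment> \<open>As \<open>s + 1\<close> is odd, the least even order above \<open>s\<close> is \<open>s + 2\<close>.\<close>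
    have "T1 \<subseteq> Omega1 k s lam"
    proof
      fix d assume "d \<in> T1"
      then have d: "d \<in> T" "even d"
        by (simp_all add: T1_def)
      then have "s + 1 \<le> d" "d \<le> k" "d \<noteq> s + 1"
        using True by (auto simp: T_def)
      with d T True show "d \<in> Omega1 k s lam"
        by (auto simp: Omega1_def Omega2_def)
    qed
    moreover have "T1' \<subseteq> Omega1' k"
      by (auto simp: T1'_def Omega1'_def)
    moreover have "(\<Sum>d\<in>T. int (k choose d))
        = (\<Sum>d\<in>T1. int (k choose (d - 1)) + int (k choose d)) + (if card T1' = 1 then 1 else 0)"
    proof -
      have "(\<Sum>d\<in>T. int (k choose d))
          = (\<Sum>d | d \<in> T \<and> even d. int (k choose (d - 1)) + int (k choose d))
            + (if odd k \<and> k \<in> T then int (k choose k) else 0)"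
      proof (rule sum_paired_orders)
        show "d \<in> T \<longleftrightarrow> d - 1 \<in> T" if "even d" "s + 2 \<le> d" "d \<le> k" for d
          using binary_active_orders_paired [where 'l = 'l and 'k = 'k, of s d lam] that True assms
          by (auto simp: T_def D_def)
      qed (use True in \<open>auto simp: T_def\<close>)
      moreover have "T1' = (if odd k \<and> k \<in> T then {k} else {})"
        by (auto simp: T1'_def)
      ultimately show ?thesis
        by (simp add: T1_def)
    qed
    ultimately show ?thesis
      using T dim True
      by (intro exI [of _ T1] exI [of _ T1'] exI [of _ T]) simp
  qed
qed

end
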